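(* Let $a,b,c$ be positive integers and let $(x_n)_{n\in\mathbb{Z}}$ satisfy $x_n=ax_{n-1}+bx_{n-2}+cx_{n-3}$ for all $n\in\mathbb{Z}$, with $x_0,x_1,x_2\in\mathbb{Z}$. Suppose that the characteristic polynomial $x^3-ax^2-bx-c$ has a real root $\gamma>1$ and that $$\gamma^{-1}\le x_1\le\gamma^0\le x_2\le\gamma^1\le x_3\le\gamma^2.$$ If there exists a prime $p$ for which the Marques–Lengyel conjecture holds for $(x_n)$, then the equation $x_n=m!$ has only finitely many solutions in positive integers $(n,m)$.
   Context: For a nonzero rational $r$, $\nu_p(r)$ is the exponent of $p$ in $r$, and $\nu_p(0)=\infty$. The Marques–Lengyel conjecture holds for $(x_n)_{n\in\mathbb{Z}}$ and a prime $p$ if there is a positive integer $Q$ such that for every $i\in\{0,1,\dots,Q-1\}$ one of the following holds: (C) there is $\kappa_i\in\mathbb{Z}_{\ge0}$ such that $\nu_p(x_n)=\kappa_i$ for all but finitely many $n\in\mathbb{Z}$ with $n\equiv i\pmod Q$; or (L) there exist $a_i\in\mathbb{Z}$, $\kappa_i\in\mathbb{Z}$, $\mu_i\in\mathbb{Z}_{>0}$ with $\nu_p(a_i-i)\ge\nu_p(Q)$ such that $\nu_p(x_n)=\kappa_i+\mu_i\nu_p(n-a_i)$ for all but finitely many $n\in\mathbb{Z}$ with $n\equiv i\pmod Q$. *)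

theory Defs
  imports
    Complex_Main
    "HOL-Library.Extended_Real"
    "HOL-Computational_Algebra.Polynomial"
    "HOL-Computational_Algebra.Primes"
    "HOL-Number_Theory.Cong"
begin

(* quotient_of yields the numerator and the positive denominator in lowest terms;
   ereal is used only to accommodate the value infinity at 0. *)
definition nu :: "nat \<Rightarrow> rat \<Rightarrow> ereal" where
  "nu p r =
    (if r = 0 then \<infinity>
     else ereal (real (multiplicity (int p) (fst (quotient_of r)))
               - real (multiplicity (int p) (snd (quotient_of r)))))"

definition constant_on_class :: "(int \<Rightarrow> rat) \<Rightarrow> nat \<Rightarrow> int \<Rightarrow> int \<Rightarrow> bool" where
  "constant_on_class x p Q i \<longleftrightarrow>
    (\<exists>\<kappa>::int. \<kappa> \<ge> 0 \<and>
      finite {n::int. [n = i] (mod Q) \<and> nu p (x n) \<noteq> ereal (of_int \<kappa>)})"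

definition linear_on_class :: "(int \<Rightarrow> rat) \<Rightarrow> nat \<Rightarrow> int \<Rightarrow> int \<Rightarrow> bool" where
  "linear_on_class x p Q i \<longleftrightarrow>
    (\<exists>a \<kappa> \<mu> :: int. \<mu> > 0 \<and> nu p (of_int (a - i)) \<ge> nu p (of_int Q) \<and>
      finite {n::int. [n = i] (mod Q) \<and>
        nu p (x n) \<noteq> ereal (of_int \<kappa>) + ereal (of_int \<mu>) * nu p (of_int (n - a))})"

definition marques_lengyel :: "(int \<Rightarrow> rat) \<Rightarrow> nat \<Rightarrow> bool" where
  "marques_lengyel x p \<longleftrightarrow>
    (\<exists>Q::int. Q > 0 \<and>
      (\<forall>i\<in>{0..Q - 1}. constant_on_class x p Q i \<or> linear_on_class x p Q i))"

end

theory Submission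
  imports Defs "HOL-Real_Asymp.Real_Asymp"
begin

text \<open>
  The recurrence and the initial conditions give \<open>\<gamma> ^ (n - 2) \<le> x n\<close>, so that \<open>x n = m!\<close> forces
  \<open>n = O(m\<^sup>2)\<close>. The \<open>p\<close>-adic valuation of \<open>m!\<close> is at least \<open>m div p\<close>, hence linear in \<open>m\<close>, whereas
  on each residue class the valuation of \<open>x n\<close> is bounded or grows at most like
  \<open>log n = O(log m)\<close>. So \<open>m\<close>, and with it \<open>n\<close>, is bounded.
\<close>

text \<open>Each of the \<open>m div p\<close> multiples of \<open>p\<close> up to \<open>m\<close>
  contributes a factor \<open>p\<close>; this is the first term of Legendre's sum, enough for growth
  linear in \<open>m\<close>.\<close>

lemma power_div_dvd_fact: "p ^ (m div p) dvd (fact m :: nat)" if "p > 0"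
proof -
  have "p ^ k dvd (fact (p * k) :: nat)" for k
  proof (induction k)
    case (Suc k)
    have eq: "fact (p * Suc k) = (p * Suc k) * (fact (p * Suc k - 1) :: nat)"
      using that by (subst fact_reduce) auto
    have "(fact (p * k) :: nat) dvd fact (p * Suc k - 1)"
      using that by (intro fact_dvd) auto
    with Suc have "p ^ k dvd (fact (p * Suc k - 1) :: nat)"
      by (rule dvd_trans)
    then have "p * p ^ k dvd (p * Suc k) * (fact (p * Suc k - 1) :: nat)"
      by (intro mult_dvd_mono) auto
    then show ?case by (simp only: eq power_Suc)
  qed simp
  then have "p ^ (m div p) dvd (fact (p * (m div p)) :: nat)" .
  also have "\<dots> dvd fact m" by (intro fact_dvd) simp
  finally show ?thesis .
qed

lemma nu_of_int: "nu p (of_int z) = ereal (real (multiplicity (int p) z))" if "z \<noteq> 0"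
  using that by (simp add: nu_def quotient_of_int[unfolded Rat.of_int_def])

lemma nu_fact_ge: "ereal (real m / real p - 1) \<le> nu p (fact m)" if "prime p"
proof -
  have p: "p > 1" using that by (rule prime_gt_1_nat)
  have "int (p ^ (m div p)) dvd int (fact m)"
    using power_div_dvd_fact[of p m] p by (simp only: of_nat_dvd_iff)
  then have "int p ^ (m div p) dvd fact m" by simp
  then have "m div p \<le> multiplicity (int p) (fact m)"
    using that by (intro multiplicity_geI) auto
  \<comment> \<open>\<open>m div p\<close> is the floor of \<open>m / p\<close>, so the
    \<open>- 1\<close> pays for rounding.\<close>
  moreover have "real m / real p - 1 \<le> real (m div p)"
    using floor_divide_of_nat_eq[of m p, where 'a = real] by linarith
  ultimately have "real m / real p - 1 \<le> real (multiplicity (int p) (fact m))"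
    by linarith
  moreover have "nu p (fact m) = ereal (real (multiplicity (int p) (fact m)))"
    using nu_of_int[of "fact m" p] by simp
  ultimately show ?thesis by simp
qed

text \<open>The power of \<open>p\<close> dividing a nonzero \<open>z\<close> is at most
  \<open>\<bar>z\<bar>\<close>; lowering the base from \<open>p\<close> to 2 makes the bound uniform
  in \<open>p\<close>.\<close>

lemma multiplicity_le_log2:
  fixes z :: int
  assumes "prime p" "z \<noteq> 0"
  shows "real (multiplicity (int p) z) \<le> ln (real_of_int \<bar>z\<bar>) / ln 2"
proof -
  let ?w = "multiplicity (int p) z"
  have "int p ^ ?w \<le> \<bar>z\<bar>"
    using assms(2) by (intro zdvd_imp_le) (auto simp: multiplicity_dvd)
  moreover have "2 ^ ?w \<le> int p ^ ?w"
    using prime_ge_2_nat[OF assms(1)] by (intro power_mono) auto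
  ultimately have "2 ^ ?w \<le> \<bar>z\<bar>" by linarith
  then have "real_of_int (2 ^ ?w) \<le> real_of_int \<bar>z\<bar>" by (simp only: of_int_le_iff)
  then have "(2::real) ^ ?w \<le> real_of_int \<bar>z\<bar>" by simp
  then have "ln ((2::real) ^ ?w) \<le> ln (real_of_int \<bar>z\<bar>)"
    using assms(2) by (subst ln_le_cancel_iff) auto
  then show ?thesis by (simp add: ln_realpow field_simps)
qed

text \<open>The left side is linear in \<open>m\<close>, the right side is O(log \<open>m\<close>),
  so the inequality fails from some threshold \<open>M\<close> on.\<close>

lemma valuation_bound_imp_bounded:
  fixes K \<mu> A L p :: real
  assumes "\<mu> > 0" "L > 0" "p > 0"
  obtains M :: nat where
    "\<And>m. real m / p - 1 \<le> K + \<mu> * (ln (A + real m ^ 2 / L) / ln 2) \<Longrightarrow> m < M"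
proof -
  have "eventually (\<lambda>m::nat. K + \<mu> * (ln (A + real m ^ 2 / L) / ln 2) < real m / p - 1) sequentially"
    using assms by real_asymp
  then obtain M where "\<And>m. m \<ge> M \<Longrightarrow> K + \<mu> * (ln (A + real m ^ 2 / L) / ln 2) < real m / p - 1"
    unfolding eventually_sequentially by blast
  then show ?thesis using that[of M] by (meson not_le)
qed

text \<open>Outside a finite set \<open>E\<close> of indices, both alternatives lead to an
  inequality of the same shape, linear in \<open>m\<close> against logarithmic. It bounds
  \<open>m\<close>, and \<open>bound\<close> then bounds \<open>n\<close>.\<close>

lemma finite_factorial_indices_on_class:
  fixes x :: "int \<Rightarrow> rat"
  assumes p: "prime p" and L: "L > 0"
    and bound: "\<And>n m. n > 0 \<Longrightarrow> x n = fact m \<Longrightarrow> real_of_int n \<le> 2 + real m ^ 2 / L"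
    and cls: "constant_on_class x p Q i \<or> linear_on_class x p Q i"
  shows "finite {n. [n = i] (mod Q) \<and> n > 0 \<and> (\<exists>m. x n = fact m)}" (is "finite ?S")
proof -
  obtain E K \<mu> A where E: "finite E" and \<mu>: "\<mu> > 0"
    and le: "\<And>n m. n \<in> ?S \<Longrightarrow> n \<notin> E \<Longrightarrow> x n = fact m \<Longrightarrow>
        real m / p - 1 \<le> K + \<mu> * (ln (A + real m ^ 2 / L) / ln 2)"
    using cls
  proof
    assume "constant_on_class x p Q i"
    then obtain \<kappa> :: int where
      fin: "finite {n. [n = i] (mod Q) \<and> nu p (x n) \<noteq> ereal (of_int \<kappa>)}" (is "finite ?E")
      unfolding constant_on_class_def by blast
    \<comment> \<open>The logarithm of a number at least 1 is nonnegative, so it can be added to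
      \<kappa> to match the linear case, with \<open>1\<close> for \<mu> and for
      \<open>A\<close>.\<close>
    have "real m / p - 1 \<le> real_of_int \<kappa> + 1 * (ln (1 + real m ^ 2 / L) / ln 2)"
      if "n \<in> ?S" "n \<notin> ?E" "x n = fact m" for n m
    proof -
      have "nu p (fact m) = ereal (of_int \<kappa>)" using that by auto
      with nu_fact_ge[OF p, of m] have "real m / p - 1 \<le> \<kappa>" by simp
      moreover have "ln (1 + real m ^ 2 / L) / ln 2 \<ge> 0" using L by simp
      ultimately show ?thesis by simp
    qed
    with fin show ?thesis by (rule that[of ?E 1, OF _ zero_less_one])
  next
    assume "linear_on_class x p Q i"
    then obtain a \<kappa> \<mu> :: int where \<mu>: "\<mu> > 0" and
      fin: "finite {n. [n = i] (mod Q) \<and>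
        nu p (x n) \<noteq> ereal (of_int \<kappa>) + ereal (of_int \<mu>) * nu p (of_int (n - a))}" (is "finite ?E")
      unfolding linear_on_class_def by blast
    \<comment> \<open>The index \<open>a\<close> joins the exceptional set because
      \<open>nu p 0\<close> is infinite. The constant comes from
      \<open>\<bar>n - a\<bar> \<le> n + \<bar>a\<bar>\<close> for \<open>n > 0\<close>, with
      \<open>bound\<close> applied to \<open>n\<close>.\<close>
    have "real m / p - 1 \<le> real_of_int \<kappa> + real_of_int \<mu> * (ln ((2 + \<bar>of_int a\<bar>) + real m ^ 2 / L) / ln 2)"
      if n: "n \<in> ?S" "n \<notin> insert a ?E" "x n = fact m" for n m
    proof -
      have na: "n - a \<noteq> 0" using n by auto
      let ?w = "multiplicity (int p) (n - a)"
      have "nu p (fact m) = ereal (of_int \<kappa>) + ereal (of_int \<mu>) * nu p (of_int (n - a))"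
        using n by auto
      then have "nu p (fact m) = ereal (of_int \<kappa> + of_int \<mu> * real ?w)"
        by (simp add: nu_of_int[OF na] del: of_int_diff)
      with nu_fact_ge[OF p, of m] have 1: "real m / p - 1 \<le> of_int \<kappa> + of_int \<mu> * real ?w" by simp
      have "real_of_int n \<le> 2 + real m ^ 2 / L" "n > 0" using n bound by auto
      then have "real_of_int \<bar>n - a\<bar> \<le> 2 + \<bar>of_int a\<bar> + real m ^ 2 / L" by simp
      then have "ln (real_of_int \<bar>n - a\<bar>) \<le> ln (2 + \<bar>of_int a\<bar> + real m ^ 2 / L)"
        using na by (intro ln_mono) auto
      then have "real ?w \<le> ln (2 + \<bar>of_int a\<bar> + real m ^ 2 / L) / ln 2"
        using multiplicity_le_log2[OF p na] by (meson divide_right_mono ln_ge_zero order_trans one_le_numeral)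
      then have "real_of_int \<mu> * real ?w \<le> of_int \<mu> * (ln (2 + \<bar>of_int a\<bar> + real m ^ 2 / L) / ln 2)"
        using \<mu> by (intro mult_left_mono) auto
      with 1 show ?thesis by linarith
    qed
    moreover have "finite (insert a ?E)" using fin by simp
    moreover have "real_of_int \<mu> > 0" using \<mu> by simp
    ultimately show ?thesis by (intro that[of "insert a ?E" "of_int \<mu>"])
  qed
  have "real p > 0" using p by (simp add: prime_gt_0_nat)
  then obtain M where
    M: "\<And>m. real m / p - 1 \<le> K + \<mu> * (ln (A + real m ^ 2 / L) / ln 2) \<Longrightarrow> m < M"
    using valuation_bound_imp_bounded[OF \<mu> L] by metis
  \<comment> \<open>For \<open>n\<close> outside \<open>E\<close>, \<open>m < M\<close> makes the
    bound on \<open>n\<close> independent of \<open>m\<close>.\<close>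
  have "?S \<subseteq> E \<union> {0..\<lceil>2 + real M ^ 2 / L\<rceil>}"
  proof
    fix n assume n: "n \<in> ?S"
    then obtain m where m: "x n = fact m" by blast
    show "n \<in> E \<union> {0..\<lceil>2 + real M ^ 2 / L\<rceil>}"
    proof (cases "n \<in> E")
      case False
      then have "m < M" using M le n m by blast
      then have "real m ^ 2 / L \<le> real M ^ 2 / L"
        using L by (intro divide_right_mono power_mono) auto
      with bound[of n m] n m have "real_of_int n \<le> 2 + real M ^ 2 / L" by simp
      then have "n \<le> \<lceil>2 + real M ^ 2 / L\<rceil>" by linarith
      with n show ?thesis by simp
    qed simp
  qed
  then show ?thesis by (rule finite_subset) (use E in simp)
qed

text \<open>The powers of \<gamma> satisfy the same recurrence, and nonnegative coefficients carry
  the inequality from three consecutive terms to the next.\<close>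

lemma cubic_recurrence_lower_bound:
  fixes y :: "nat \<Rightarrow> real"
  assumes rec: "\<And>k. y (k + 3) = a * y (k + 2) + b * y (k + 1) + c * y k"
    and nonneg: "a \<ge> 0" "b \<ge> 0" "c \<ge> 0"
    and root: "\<gamma> ^ 3 = a * \<gamma> ^ 2 + b * \<gamma> + c"
    and init: "1 \<le> y 0" "\<gamma> \<le> y 1" "\<gamma> ^ 2 \<le> y 2"
  shows "\<gamma> ^ k \<le> y k"
proof (induction k rule: less_induct)
  case (less k)
  show ?case
  proof (cases "k < 3")
    case True
    then have "k = 0 \<or> k = 1 \<or> k = 2" by auto
    then show ?thesis using init by auto
  next
    case False
    define j where "j = k - 3"
    have k: "k = j + 3" using False by (simp add: j_def)
    have "\<gamma> ^ k = \<gamma> ^ j * (a * \<gamma> ^ 2 + b * \<gamma> + c)"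
      using root by (simp only: k power_add)
    also have "\<dots> = a * \<gamma> ^ (j + 2) + b * \<gamma> ^ (j + 1) + c * \<gamma> ^ j"
      by (simp add: algebra_simps power2_eq_square)
    also have "\<dots> \<le> a * y (j + 2) + b * y (j + 1) + c * y j"
      using nonneg by (intro add_mono mult_left_mono less.IH) (auto simp: k)
    finally show ?thesis by (simp only: k rec)
  qed
qed

text \<open>From \<open>m! \<le> m ^ m\<close> and \<open>ln m \<le> m\<close>. The crude bound
  suffices, since it later enters only under a logarithm.\<close>

lemma ln_fact_le: "ln (fact m) \<le> real m ^ 2"
proof (cases "m = 0")
  case False
  have "ln (fact m :: real) \<le> ln (real (m ^ m))"
    using fact_le_power[of m, where 'a = real]
    by (intro ln_mono) auto
  also have "\<dots> = real m * ln (real m)" using False by (simp add: ln_realpow)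
  also have "\<dots> \<le> real m * real m"
    using False ln_bound[of "real m"] by (intro mult_left_mono) auto
  finally show ?thesis by (simp add: power2_eq_square)
qed simp

theorem theorem1p12:
  fixes a b c :: int and x :: "int \<Rightarrow> rat" and \<gamma> :: real
  assumes "a > 0" and "b > 0" and "c > 0"
    and "\<And>n::int. x n = of_int a * x (n - 1) + of_int b * x (n - 2) + of_int c * x (n - 3)"
    and "x 0 \<in> \<int>" and "x 1 \<in> \<int>" and "x 2 \<in> \<int>"
    and "poly [:- of_int c, - of_int b, - of_int a, 1:] \<gamma> = 0" and "\<gamma> > 1"
    and "\<gamma> powi (-1) \<le> of_rat (x 1)" and "of_rat (x 1) \<le> \<gamma> powi 0"
    and "\<gamma> powi 0 \<le> of_rat (x 2)" and "of_rat (x 2) \<le> \<gamma> powi 1"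
    and "\<gamma> powi 1 \<le> of_rat (x 3)" and "of_rat (x 3) \<le> \<gamma> powi 2"
    and "\<exists>p::nat. prime p \<and> marques_lengyel x p"
  shows "finite {(n::int, m::nat). n > 0 \<and> m > 0 \<and> x n = fact m}"
proof -
  define L where "L = ln \<gamma>"
  have L: "L > 0" using \<open>\<gamma> > 1\<close> by (simp add: L_def)
  \<comment> \<open>Shifting by one and scaling by \<gamma> turns the lower bounds on
    \<open>x 1\<close>, \<open>x 2\<close>, \<open>x 3\<close> into 1, \<gamma>,
    \<open>\<gamma> ^ 2\<close> for \<open>y 0\<close>, \<open>y 1\<close>,
    \<open>y 2\<close>.\<close>
  define y where "y = (\<lambda>k::nat. \<gamma> * real_of_rat (x (int k + 1)))"
  have lower: "\<gamma> ^ k \<le> y k" for k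
  proof (rule cubic_recurrence_lower_bound)
    show "y (k + 3) = of_int a * y (k + 2) + of_int b * y (k + 1) + of_int c * y k" for k
      using assms(4)[of "int k + 4"] by (simp add: y_def of_rat_add of_rat_mult algebra_simps)
    show "\<gamma> ^ 3 = of_int a * \<gamma> ^ 2 + of_int b * \<gamma> + of_int c"
      using assms(8) by (simp add: algebra_simps power2_eq_square power3_eq_cube)
    show "1 \<le> y 0" using assms(9,10) by (simp add: y_def field_simps)
    show "\<gamma> \<le> y 1" using assms(9,12) by (simp add: y_def)
    show "\<gamma> ^ 2 \<le> y 2" using assms(9,14) by (simp add: y_def power2_eq_square)
  qed (use assms(1-3) in auto)
  \<comment> \<open>Take logarithms in \<open>\<gamma> ^ (n - 1) \<le> \<gamma> * m!\<close>. The 2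
    collects the index shift and the factor \<gamma>.\<close>
  have bound: "real_of_int n \<le> 2 + real m ^ 2 / L" if "n > 0" "x n = fact m" for n m
  proof -
    define k where "k = nat (n - 1)"
    have n: "n = int k + 1" using that(1) by (simp add: k_def)
    have "real_of_rat (fact m) = fact m"
      using of_rat_of_int_eq[of "fact m"] by simp
    then have "y k = \<gamma> * fact m" using that(2) by (simp add: y_def n)
    with lower[of k] have "ln (\<gamma> ^ k) \<le> ln (\<gamma> * fact m)"
      using \<open>\<gamma> > 1\<close> by (intro ln_mono) auto
    then have "real k * L \<le> L + ln (fact m)"
      using \<open>\<gamma> > 1\<close> by (simp add: L_def ln_realpow ln_mult)
    also have "\<dots> \<le> L + real m ^ 2" using ln_fact_le by simp
    finally have "real k \<le> 1 + real m ^ 2 / L" using L by (simp add: field_simps)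
    then show ?thesis by (simp add: n)
  qed
  obtain p Q where p: "prime p" and Q: "Q > 0"
    and cls: "\<And>i. i \<in> {0..Q - 1} \<Longrightarrow> constant_on_class x p Q i \<or> linear_on_class x p Q i"
    using assms(16) unfolding marques_lengyel_def by blast
  define N where "N = {n. n > 0 \<and> (\<exists>m. x n = fact m)}"
  \<comment> \<open>Every index lies in the class of its residue \<open>n mod Q\<close>, so
    finiteness on the finitely many classes suffices.\<close>
  have "N \<subseteq> (\<Union>i\<in>{0..Q - 1}. {n. [n = i] (mod Q) \<and> n > 0 \<and> (\<exists>m. x n = fact m)})"
  proof
    fix n assume "n \<in> N"
    moreover have "n mod Q \<in> {0..Q - 1}" using Q by simp
    moreover have "[n = n mod Q] (mod Q)" by (simp add: cong_def)
    ultimately show "n \<in> (\<Union>i\<in>{0..Q - 1}. {n. [n = i] (mod Q) \<and> n > 0 \<and> (\<exists>m. x n = fact m)})"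
      unfolding N_def by blast
  qed
  moreover have "finite (\<Union>i\<in>{0..Q - 1}. {n. [n = i] (mod Q) \<and> n > 0 \<and> (\<exists>m. x n = fact m)})"
    using finite_factorial_indices_on_class[OF p L bound cls] by blast
  ultimately have "finite N" by (rule finite_subset)
  \<comment> \<open>Fibres are finite because \<open>m \<le> m!\<close>; over
    \<open>m \<ge> 0\<close> they need not be singletons, as \<open>0! = 1!\<close>.\<close>
  moreover have "finite {m. x n = fact m}" for n
  proof (rule finite_subset)
    show "{m. x n = fact m} \<subseteq> {..nat \<lceil>x n\<rceil>}"
    proof
      fix m assume "m \<in> {m. x n = fact m}"
      then have "\<lceil>x n\<rceil> = int (fact m)"
        using ceiling_of_int[of "fact m", where 'a = rat] by simp
      then show "m \<in> {..nat \<lceil>x n\<rceil>}" using fact_ge_self[of m] by (simp only: nat_int atMost_iff)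
    qed
  qed simp
  \<comment> \<open>Finitely many indices with finite fibres give a finite set of pairs containing
    all solutions.\<close>
  ultimately have "finite (SIGMA n:N. {m. x n = fact m})" by blast
  then show ?thesis by (rule rev_finite_subset) (auto simp: N_def)
qed

end
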